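(* For the $n\times n$ board and for each of the two colors, the minimum number of days in which a bishop can survey all the cells of that color is $n-2$.
   Context: Cells of the $n\times n$ board are $(x,y)$ with $1\le x,y\le n$. The cell $(x,y)$ is white if $x+y$ is odd and black if $x+y$ is even. A bishop can move from a cell to any other cell on the board lying on a line of slope $1$ or $-1$ through it; in particular it always stays on cells of one color. A bishop's survey of the cells of a given color in $m$ days is a sequence of cells $p_1,\dots,p_m$ of that color such that for each $i<m$ the bishop can move from $p_i$ to $p_{i+1}$ in one move, and every cell of that color either equals some $p_i$ or can be reached in one bishop move from some $p_i$. The starting cell $p_1$ can be chosen freely.
   Formalization: The claim is proved for both colors when n ≥ 4 and for black when n = 3; it is false in the excluded cases: n = 1 and n = 2 (n-2 is -1 or 0), and the white cells of the 3×3 board, where no single cell sees all four white cells, so 2 days are needed. *)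

theory Defs
  imports Main
begin

datatype color = White | Black

fun cell_color :: "int \<times> int \<Rightarrow> color" where
  "cell_color (x, y) = (if odd (x + y) then White else Black)"

definition cells :: "nat \<Rightarrow> color \<Rightarrow> (int \<times> int) set" where
  "cells n c = {p \<in> {1..int n} \<times> {1..int n}. cell_color p = c}"

(* p and q are distinct and lie on a common line of slope 1 or -1; that both cells
   are on the board is required separately wherever this relation is used. *)
definition bishop_move :: "int \<times> int \<Rightarrow> int \<times> int \<Rightarrow> bool" where
  "bishop_move p q \<longleftrightarrow> p \<noteq> q \<and>
     (snd q - snd p = fst q - fst p \<or> snd q - snd p = - (fst q - fst p))"

(* The number of days of a survey is the length of the list; list positions count from 0. *)
definition bishop_survey :: "nat \<Rightarrow> color \<Rightarrow> (int \<times> int) list \<Rightarrow> bool" where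
  "bishop_survey n c ps \<longleftrightarrow>
     set ps \<subseteq> cells n c \<and>
     (\<forall>i. Suc i < length ps \<longrightarrow> bishop_move (ps ! i) (ps ! Suc i)) \<and>
     (\<forall>q \<in> cells n c. \<exists>p \<in> set ps. q = p \<or> bishop_move p q)"

end

theory Submission
  imports Defs
begin

text \<open>
  Label each cell by the two diagonals through it, one of slope \<open>-1\<close> (constant coordinate sum)
  and one of slope \<open>1\<close> (constant coordinate difference).  A cell is seen from another exactly
  when the two share a diagonal, so what a survey sees depends only on the set of diagonals that
  it occupies.

  Lower bound.  The first cell of a survey occupies two diagonals and every later cell lies on a
  diagonal of its predecessor, hence adds at most one: \<open>m\<close> days occupy at most \<open>m + 1\<close> diagonals
  (\<open>card_occupied_diagonals\<close>).  On the other hand each color contains \<open>n - 1\<close> cells on the left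
  and right edges no two of which share a diagonal (\<open>edge_cells_independent\<close>).  A survey must
  occupy a diagonal of each of them, and these diagonals are different, so \<open>n - 1 \<le> m + 1\<close>.

  Upper bound.  Near the center the diagonals are long, and it suffices to occupy \<open>n - 1\<close> central
  ones.  For black, walking along the main diagonal without its two corners meets every black diagonal of
  slope \<open>-1\<close> that has more than one cell, and the two corners lie on the main diagonal itself.  For white, there
  are two diagonals next to the main one; walking along one of them and crossing over to the other
  at the end leaves out only the two shortest diagonals of slope \<open>-1\<close>, whose cells lie on these
  two diagonals.
\<close>

section \<open>Diagonals\<close>

definition diagonals :: "int \<times> int \<Rightarrow> (int + int) set" where
  "diagonals p = {Inl (fst p + snd p), Inr (snd p - fst p)}"

lemma seen_iff_common_diagonal:
  "q = p \<or> bishop_move p q \<longleftrightarrow> diagonals p \<inter> diagonals q \<noteq> {}"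
  by (cases p; cases q) (auto simp: diagonals_def bishop_move_def)

section \<open>The lower bound\<close>

text \<open>
  Of the two diagonals of a cell prepended to a walk, the next cell already occupies at least one.
\<close>

lemma card_occupied_diagonals:
  assumes "successively bishop_move ps"
  shows "card (\<Union> (diagonals ` set ps)) \<le> Suc (length ps)"
  using assms
proof (induction ps rule: induct_list012)
  case 1
  show ?case by simp
next
  case (2 p)
  show ?case by (simp add: diagonals_def card_insert_if)
next
  case (3 p q ps)
  let ?U = "\<Union> (diagonals ` set (q # ps))"
  have "finite ?U"
    by (auto simp: diagonals_def)
  have "diagonals p \<inter> diagonals q \<noteq> {}"
    using "3.prems" seen_iff_common_diagonal[of q p] by auto
  then have "diagonals p \<inter> ?U \<noteq> {}"
    by auto
  then obtain a where "diagonals p \<union> ?U \<subseteq> insert a ?U"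
    unfolding diagonals_def by blast
  then have "card (diagonals p \<union> ?U) \<le> card (insert a ?U)"
    using \<open>finite ?U\<close> by (intro card_mono) auto
  also have "\<dots> \<le> Suc (card ?U)"
    by (rule card_insert_le_m1) auto
  also have "\<dots> \<le> Suc (Suc (length (q # ps)))"
    using "3.IH"(2) "3.prems" by simp
  finally show ?case by simp
qed

text \<open>
  Assign to each of the independent cells a diagonal through which the survey sees it.
  Independence makes this assignment injective.
\<close>

lemma independent_cells_le_survey:
  assumes survey: "bishop_survey n c ps"
    and Q: "Q \<subseteq> cells n c"
    and indep: "\<And>p q. \<lbrakk>p \<in> Q; q \<in> Q; p \<noteq> q\<rbrakk> \<Longrightarrow> diagonals p \<inter> diagonals q = {}"
  shows "card Q \<le> Suc (length ps)"
proof -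
  let ?U = "\<Union> (diagonals ` set ps)"
  have "\<exists>a. a \<in> diagonals q \<inter> ?U" if "q \<in> Q" for q
  proof -
    obtain p where "p \<in> set ps" "q = p \<or> bishop_move p q"
      using survey Q \<open>q \<in> Q\<close> unfolding bishop_survey_def by blast
    then show ?thesis
      unfolding seen_iff_common_diagonal by blast
  qed
  then obtain f where f: "\<And>q. q \<in> Q \<Longrightarrow> f q \<in> diagonals q \<inter> ?U"
    by metis
  have "inj_on f Q"
    using f indep by (intro inj_onI) (metis IntD1 IntI empty_iff)
  moreover have "f ` Q \<subseteq> ?U"
    using f by blast
  moreover have "finite ?U"
    by (auto simp: diagonals_def)
  ultimately have "card Q \<le> card ?U"
    by (rule card_inj_on_le)
  also have "\<dots> \<le> Suc (length ps)"
    using survey by (intro card_occupied_diagonals)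
      (simp add: bishop_survey_def successively_conv_nth)
  finally show ?thesis .
qed

definition edge_cell :: "nat \<Rightarrow> int \<Rightarrow> int \<times> int" where
  "edge_cell n d = (if 0 \<le> d then (1, 1 + d) else (int n, int n + d))"

text \<open>
  These cells fill the left edge, and the right edge without its corners.  The parameter is the
  coordinate difference; the coordinate sum is \<open>d + 2\<close> or \<open>d + 2n\<close> according to the edge, and the
  two ranges \<open>2, \<dots>, n + 1\<close> and \<open>n + 2, \<dots>, 2n - 1\<close> do not overlap.
\<close>

lemma edge_cells_independent:
  assumes "d \<in> {2 - int n..int n - 1}" and "e \<in> {2 - int n..int n - 1}" and "d \<noteq> e"
  shows "diagonals (edge_cell n d) \<inter> diagonals (edge_cell n e) = {}"
  using assms by (auto simp: edge_cell_def diagonals_def)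

text \<open>
  The \<open>2n - 2\<close> differences \<open>2 - n, \<dots>, n - 1\<close> are consecutive integers, and the color of a cell is
  the parity of its difference, so each color gets exactly half of them.
\<close>

lemma survey_lower_bound:
  assumes "bishop_survey n c ps" and "n \<ge> 3"
  shows "n - 2 \<le> length ps"
proof -
  \<comment> \<open>The first admissible difference of the right parity is \<open>2 - n + r\<close>.\<close>
  define r :: int where "r = (if (c = Black) = even n then 0 else 1)"
  define d where "d k = 2 - int n + r + 2 * int k" for k
  have d_range: "d k \<in> {2 - int n..int n - 1}" if "k < n - 1" for k
    using that by (auto simp: d_def r_def)
  have inj_d: "d k = d l \<longleftrightarrow> k = l" for k l
    by (auto simp: d_def)
  have parity: "even (d k) \<longleftrightarrow> c = Black" for k
    by (auto simp: d_def r_def)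
  let ?q = "\<lambda>k. edge_cell n (d k)"
  have indep: "diagonals (?q k) \<inter> diagonals (?q l) = {}"
    if "k < n - 1" "l < n - 1" "k \<noteq> l" for k l
    using that d_range inj_d by (intro edge_cells_independent) auto
  have "diagonals p \<noteq> {}" for p
    by (simp add: diagonals_def)
  then have "inj_on ?q {..<n - 1}"
    using indep by (intro inj_onI) (metis Int_absorb lessThan_iff)
  then have "n - 1 = card (?q ` {..<n - 1})"
    by (simp add: card_image)
  also have "\<dots> \<le> Suc (length ps)"
  proof (rule independent_cells_le_survey[OF assms(1)])
    show "?q ` {..<n - 1} \<subseteq> cells n c"
    proof (rule image_subsetI)
      fix k assume "k \<in> {..<n - 1}"
      then have "k < n - 1" by simp
      from d_range[OF this] parity[of k] show "?q k \<in> cells n c"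
        using assms(2) by (cases c) (auto simp: edge_cell_def cells_def)
    qed
  qed (use indep in blast)
  finally show ?thesis by simp
qed

section \<open>Optimal surveys\<close>

lemma bishop_survey_iff_diagonals:
  "bishop_survey n c ps \<longleftrightarrow> set ps \<subseteq> cells n c \<and> successively bishop_move ps \<and>
     (\<forall>q \<in> cells n c. \<exists>p \<in> set ps. fst p + snd p = fst q + snd q \<or> snd p - fst p = snd q - fst q)"
proof -
  have "q = p \<or> bishop_move p q \<longleftrightarrow>
      fst p + snd p = fst q + snd q \<or> snd p - fst p = snd q - fst q" for p q
    unfolding seen_iff_common_diagonal by (auto simp: diagonals_def)
  then show ?thesis
    unfolding bishop_survey_def successively_conv_nth by simp
qed

lemma successively_bishop_move_along_diagonal:
  "successively bishop_move (map (\<lambda>x. (x, x + d)) [a..b])"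
  by (auto simp: successively_conv_nth bishop_move_def)

lemma main_diagonal_survey:
  assumes "n \<ge> 3"
  shows "bishop_survey n Black (map (\<lambda>x. (x, x)) [2..int n - 1])" (is "bishop_survey _ _ ?ps")
  unfolding bishop_survey_iff_diagonals
proof (intro conjI ballI)
  show "set ?ps \<subseteq> cells n Black"
    by (auto simp: cells_def)
  show "successively bishop_move ?ps"
    using successively_bishop_move_along_diagonal[of 0] by simp
  fix q assume q: "q \<in> cells n Black"
  obtain x y where xy: "q = (x, y)" by (cases q)
  from q have b: "1 \<le> x" "x \<le> int n" "1 \<le> y" "y \<le> int n" "even (x + y)"
    unfolding xy by (auto simp: cells_def split: if_splits)
  then obtain k where k: "x + y = 2 * k" by blast
  show "\<exists>p\<in>set ?ps. fst p + snd p = fst q + snd q \<or> snd p - fst p = snd q - fst q"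
  proof (cases "2 \<le> k \<and> k \<le> int n - 1")
    case True
    then show ?thesis
      by (intro bexI[of _ "(k, k)"]) (auto simp: k xy)
  next
    case False
    then have "x = y"
      using b k by linarith
    then show ?thesis
      using assms by (intro bexI[of _ "(2, 2)"]) (auto simp: xy)
  qed
qed

lemma near_diagonal_survey:
  assumes "n \<ge> 4"
  shows "bishop_survey n White
    (map (\<lambda>x. (x, x + 1)) [2..int n - 2] @ [(int n - 1, int n - 2)])" (is "bishop_survey _ _ ?ps")
  unfolding bishop_survey_iff_diagonals
proof (intro conjI ballI)
  show "set ?ps \<subseteq> cells n White"
    using assms by (auto simp: cells_def)
  have "[2..int n - 2] \<noteq> []" and "last [2..int n - 2] = int n - 2"
    using assms upto_rec2[of 2 "int n - 2"] by auto
  then show "successively bishop_move ?ps"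
    using successively_bishop_move_along_diagonal[of 1 2 "int n - 2"]
    by (auto simp: successively_append_iff last_map bishop_move_def)
  fix q assume q: "q \<in> cells n White"
  obtain x y where xy: "q = (x, y)" by (cases q)
  from q have b: "1 \<le> x" "x \<le> int n" "1 \<le> y" "y \<le> int n" "odd (x + y)"
    unfolding xy by (auto simp: cells_def split: if_splits)
  then obtain k where k: "x + y = 2 * k + 1"
    using oddE by blast
  show "\<exists>p\<in>set ?ps. fst p + snd p = fst q + snd q \<or> snd p - fst p = snd q - fst q"
  proof (cases "2 \<le> k \<and> k \<le> int n - 2")
    case True
    then show ?thesis
      by (intro bexI[of _ "(k, k + 1)"]) (auto simp: k xy)
  next
    case False
    then have "k = 1 \<or> k = int n - 1"
      using b k by linarith
    then have "x = 1 \<and> y = 2 \<or> x = 2 \<and> y = 1 \<or>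
        x = int n - 1 \<and> y = int n \<or> x = int n \<and> y = int n - 1"
      using b k by linarith
    then have "y - x = 1 \<or> y - x = - 1"
      by auto
    then show ?thesis
    proof
      assume "y - x = 1"
      then show ?thesis
        using assms by (intro bexI[of _ "(2, 3)"]) (auto simp: xy)
    next
      assume "y - x = - 1"
      then show ?thesis
        by (intro bexI[of _ "(int n - 1, int n - 2)"]) (auto simp: xy)
    qed
  qed
qed

theorem mainTheorem5:
  fixes n :: nat and c :: color
  assumes "n \<ge> 3" and "n = 3 \<Longrightarrow> c = Black"
  shows "(\<exists>ps. bishop_survey n c ps \<and> length ps = n - 2) \<and>
         (\<forall>ps. bishop_survey n c ps \<longrightarrow> n - 2 \<le> length ps)"
proof (intro conjI allI impI)
  show "\<exists>ps. bishop_survey n c ps \<and> length ps = n - 2"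
  proof (cases c)
    case Black
    then show ?thesis
      using main_diagonal_survey[OF assms(1)] by (intro exI conjI) auto
  next
    case White
    with assms have "n \<ge> 4"
      by (cases "n = 3") auto
    then show ?thesis
      using near_diagonal_survey White by (intro exI conjI) auto
  qed
qed (rule survey_lower_bound[OF _ assms(1)])

end
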